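(* Let $p, r, n$ be positive integers, let $a_1,\dots,a_n\in\mathbb{F}$, let $s=\sum_{i=1}^n a_i$, and assume $s\neq 0$. Let $\widehat s$ be the random value computed by pairwise summation of $a_1,\dots,a_n$ (along a binary tree of depth $h=\lceil\log_2(n)\rceil$, as defined in the context) when every addition is rounded with limited-precision stochastic rounding $\mathrm{SR}_{p,r}$. Then for all $0<\lambda<1$, with probability at least $1-\lambda$, $$\frac{|\widehat s-s|}{|s|}\le \kappa(a)\left(\sqrt{u_p\,\gamma_{2\lceil\log_2(n)\rceil}(u_p)}\,\sqrt{\ln(2/\lambda)}+\gamma_{\lceil\log_2(n)\rceil}(u_p+u_{p+r})-\gamma_{\lceil\log_2(n)\rceil}(u_p)\right),$$ where $$\kappa(a)=\frac{\sum_{i=1}^n|a_i|}{\left|\sum_{i=1}^n a_i\right|}.$$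
   Context: Notation: $u_k:=2^{1-k}$ for a positive integer $k$, and $\gamma_m(u):=(1+u)^m-1$. Floating-point system: $\mathbb{F}\subset\mathbb{R}$ is the binary floating-point number system with $p$ significant bits, with underflow and overflow ignored, i.e. $\mathbb{F}=\{m\,2^e : m,e\in\mathbb{Z},\ |m|<2^p\}$ (this includes $0$). For $y\in\mathbb{R}$, let $\lceil y\rceil_p=\min\{z\in\mathbb{F}: z\ge y\}$ and $\lfloor y\rfloor_p=\max\{z\in\mathbb{F}: z\le y\}$ denote the neighbouring precision-$p$ floating-point numbers. Let $\mathrm{fl}_{p+r}(y)$ denote $y$ with its binary representation truncated (rounded toward zero) to its first $p+r$ significant binary digits, with $\mathrm{fl}_{p+r}(0)=0$. Limited-precision stochastic rounding with $r$ random bits: for $y\in\mathbb{R}\setminus\mathbb{F}$, $\mathrm{SR}_{p,r}(y)$ is the two-valued random variable equal to $\lceil y\rceil_p$ with probability $q_r(y)$ and to $\lfloor y\rfloor_p$ with probability $1-q_r(y)$, where $$q_r(y)=\frac{\mathrm{fl}_{p+r}(y)-\lfloor y\rfloor_p}{\lceil y\rceil_p-\lfloor y\rfloor_p}.$$ For $y\in\mathbb{F}$, $\mathrm{SR}_{p,r}(y)=y$. In a sequence of operations, each rounding uses fresh randomness independent of that used by all the other roundings: conditionally on the outcomes of all previous roundings, the result of rounding the (then determined) exact result $y$ of the current operation has the distribution of $\mathrm{SR}_{p,r}(y)$ given above. Pairwise summation: let $h=\lceil\log_2(n)\rceil$ and set $a_i=0$ for $n<i\le 2^h$ (padding with zeros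 does not alter the sum). Put $\widehat s^{\,0}_i=a_i$ for $1\le i\le 2^h$ and, for $j=1,\dots,h$ and $1\le i\le 2^{h-j}$, $$\widehat s^{\,j}_i=\mathrm{SR}_{p,r}\bigl(\widehat s^{\,j-1}_{2i-1}+\widehat s^{\,j-1}_{2i}\bigr).$$ The computed sum is $\widehat s=\widehat s^{\,h}_1$. Equivalently, $\widehat s=\sum_{i=1}^{2^h}a_i\prod_{j=1}^h\bigl(1+\delta^{j}_{\lceil i/2^j\rceil}\bigr)$, where $\delta^j_i$ is the relative error of the rounding producing $\widehat s^{\,j}_i$ (taken to be $0$ when the exact result being rounded is $0$). *)

theory Defs
  imports "HOL-Probability.Probability" "HOL-Library.Float"
begin

definition unit_roundoff :: "nat \<Rightarrow> real" where
  "unit_roundoff k = 2 powi (1 - int k)"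

definition gamma_err :: "nat \<Rightarrow> real \<Rightarrow> real" where
  "gamma_err m u = (1 + u) ^ m - 1"

definition fp_numbers :: "nat \<Rightarrow> real set" where
  "fp_numbers p = {of_int m * 2 powi e | m e :: int. \<bar>m\<bar> < 2 ^ p}"

definition fp_ceil :: "nat \<Rightarrow> real \<Rightarrow> real" where
  "fp_ceil p y = (LEAST z. z \<in> fp_numbers p \<and> y \<le> z)"

definition fp_floor :: "nat \<Rightarrow> real \<Rightarrow> real" where
  "fp_floor p y = (GREATEST z. z \<in> fp_numbers p \<and> z \<le> y)"

text \<open>
  Truncation toward zero to the first \<open>k\<close> significant binary digits, for \<open>k > 0\<close>.
  The function \<^const>\<open>truncate_down\<close> rounds toward minus infinity and its precision argument
  counts the digits after the leading one, whence the sign factor and \<open>k - 1\<close>.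
\<close>

definition fl_trunc :: "nat \<Rightarrow> real \<Rightarrow> real" where
  "fl_trunc k y = sgn y * truncate_down (k - 1) \<bar>y\<bar>"

definition sr_prob :: "nat \<Rightarrow> nat \<Rightarrow> real \<Rightarrow> real" where
  "sr_prob p r y = (fl_trunc (p + r) y - fp_floor p y) / (fp_ceil p y - fp_floor p y)"

definition stoch_round :: "nat \<Rightarrow> nat \<Rightarrow> real \<Rightarrow> real pmf" where
  "stoch_round p r y =
     (if y \<in> fp_numbers p then return_pmf y
      else map_pmf (\<lambda>up. if up then fp_ceil p y else fp_floor p y)
             (bernoulli_pmf (sr_prob p r y)))"

text \<open>
  \<open>pairwise_node p r b j i\<close> is the distribution of the computed value at level \<open>j\<close>, position \<open>i\<close>
  (counted from 1) of the summation tree with leaves \<open>b 1, b 2, \<dots>\<close>. The subtrees below distinct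
  nodes of a level share no rounding, so sequencing them with \<^const>\<open>bind_pmf\<close> expresses
  that every rounding uses fresh randomness, independent of all the others.
\<close>

fun pairwise_node :: "nat \<Rightarrow> nat \<Rightarrow> (nat \<Rightarrow> real) \<Rightarrow> nat \<Rightarrow> nat \<Rightarrow> real pmf" where
  "pairwise_node p r b 0 i = return_pmf (b i)"
| "pairwise_node p r b (Suc j) i =
     bind_pmf (pairwise_node p r b j (2 * i - 1)) (\<lambda>x.
     bind_pmf (pairwise_node p r b j (2 * i)) (\<lambda>y.
     stoch_round p r (x + y)))"

definition tree_depth :: "nat \<Rightarrow> nat" where
  "tree_depth n = nat \<lceil>log 2 (real n)\<rceil>"

definition pairwise_sum :: "nat \<Rightarrow> nat \<Rightarrow> (nat \<Rightarrow> real) \<Rightarrow> nat \<Rightarrow> real pmf" where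
  "pairwise_sum p r a n =
     pairwise_node p r (\<lambda>i. if i \<le> n then a i else 0) (tree_depth n) 1"

definition cond_number :: "(nat \<Rightarrow> real) \<Rightarrow> nat \<Rightarrow> real" where
  "cond_number a n = (\<Sum>i=1..n. \<bar>a i\<bar>) / \<bar>\<Sum>i=1..n. a i\<bar>"

end

theory Submission
  imports Defs
begin

text \<open>
  Write \<open>u = u\<^sub>p\<close> and \<open>v = u\<^sub>p\<^sub>+\<^sub>r\<close>. A rounded sum takes values in an interval of width at most \<open>u \<bar>y\<bar>\<close>
  around the exact sum \<open>y\<close>, and its mean is the truncation of \<open>y\<close> to \<open>p + r\<close> digits, which differs
  from \<open>y\<close> by at most \<open>v \<bar>y\<bar>\<close>. Hoeffding's lemma bounds the moment generating function of one
  rounding, and since a node at level \<open>j\<close> never exceeds \<open>(1 + u)\<^sup>j\<close> times the sum of the moduli of its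
  leaves, these bounds multiply up along the tree to a sub-Gaussian bound for the total error,
  shifted by the accumulated bias. Chernoff's inequality on both sides finishes the proof.
\<close>

section \<open>Neighbouring floating-point numbers\<close>

lemma fp_numbers_uminus_iff [simp]: "- z \<in> fp_numbers p \<longleftrightarrow> z \<in> fp_numbers p"
proof -
  have *: "- z \<in> fp_numbers p" if z: "z \<in> fp_numbers p" for z
  proof -
    obtain m e :: int where "z = of_int m * 2 powi e" "\<bar>m\<bar> < 2 ^ p"
      using z unfolding fp_numbers_def by blast
    then have "- z = of_int (- m) * 2 powi e" "\<bar>- m\<bar> < 2 ^ p"
      by auto
    then show ?thesis
      unfolding fp_numbers_def by blast
  qed
  show ?thesis
    using *[of z] *[of "- z"] by auto
qed

lemma zero_in_fp_numbers [simp]: "0 \<in> fp_numbers p"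
  unfolding fp_numbers_def by (auto intro!: exI[of _ 0])

text \<open>Since the significand stays below \<open>2 ^ p\<close> in modulus, a number that reaches
  \<open>2 powi e\<close> must have an exponent of at least \<open>e + 1 - int p\<close>.\<close>

lemma fp_numbers_multiple_of_ulp:
  assumes "z \<in> fp_numbers p" "2 powi e \<le> z"
  obtains k :: int where "z = of_int k * 2 powi (e + 1 - int p)"
proof -
  obtain m e' :: int where z: "z = of_int m * 2 powi e'" and m: "\<bar>m\<bar> < 2 ^ p"
    using assms(1) unfolding fp_numbers_def by blast
  have "(of_int m :: real) < of_int (2 ^ p)"
    using m by linarith
  then have "z < 2 powi (int p + e')"
    by (simp add: z power_int_add)
  with assms(2) have "(2::real) powi e < 2 powi (int p + e')"
    by linarith
  then have "e < int p + e'"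
    by (meson power_int_increasing leD leI one_le_numeral)
  then have "(2::real) powi e' = 2 ^ nat (e' - (e + 1 - int p)) * 2 powi (e + 1 - int p)"
    by (simp flip: power_int_of_nat power_int_add)
  then have "z = of_int (m * 2 ^ nat (e' - (e + 1 - int p))) * 2 powi (e + 1 - int p)"
    by (simp add: z)
  then show ?thesis
    by (rule that)
qed

text \<open>\<open>w\<close> is the spacing of \<open>fp_numbers p\<close> in the binade of
  \<open>y\<close>, so the neighbours are the grid points around \<open>y\<close>. This explicit
  form makes them comparable with \<open>fl_trunc\<close>, which is a floor on a finer grid. The
  formulas for \<open>- y\<close> come from the symmetry of \<open>fp_numbers p\<close>.\<close>

lemma fp_neighbours_pos:
  fixes y :: real
  assumes p: "p > 0" and y: "y > 0" and ny: "y \<notin> fp_numbers p"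
  defines "w \<equiv> 2 powi (\<lfloor>log 2 y\<rfloor> + 1 - int p)"
  shows "fp_floor p y = of_int \<lfloor>y / w\<rfloor> * w"
    and "fp_ceil p y = (of_int \<lfloor>y / w\<rfloor> + 1) * w"
    and "fp_floor p (- y) = - fp_ceil p y"
    and "fp_ceil p (- y) = - fp_floor p y"
    and "w \<le> unit_roundoff p * y"
proof -
  define e where "e = \<lfloor>log 2 y\<rfloor>"
  define K where "K = \<lfloor>y / w\<rfloor>"
  have w: "w > 0"
    by (simp add: w_def)
  have "2 powr of_int e \<le> y" "y < 2 powr (of_int e + 1)"
    using y by (simp_all add: e_def le_log_iff[symmetric] log_less_iff[symmetric])
  then have ey: "2 powi e \<le> y" "y < 2 powi (e + 1)"
    by (simp_all flip: powr_real_of_int')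
  \<comment> \<open>The two ends of the binade of \<open>y\<close> in units of \<open>w\<close>;
    they confine the significand \<open>K\<close> to
    \<open>2 ^ (p - 1) \<le> K < 2 ^ p\<close>.\<close>
  have ew: "2 powi e = 2 ^ (p - 1) * w" "2 powi (e + 1) = 2 ^ p * w"
    using p by (simp_all add: w_def e_def of_nat_diff flip: power_int_of_nat power_int_add)
  have Kw: "of_int K * w \<le> y" "y < (of_int K + 1) * w"
    using w by (simp_all add: K_def pos_le_divide_eq[symmetric] pos_divide_less_eq[symmetric])
  have "(2::real) ^ (p - 1) \<le> y / w" "y / w < 2 ^ p"
    using ey w unfolding ew by (simp_all add: field_simps)
  then have K: "2 ^ (p - 1) \<le> K" "K < 2 ^ p"
    unfolding K_def by (simp_all add: le_floor_iff floor_less_iff)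
  have K0: "0 < K"
    using K(1) by (smt (verit) zero_less_power)
  have eK: "2 powi e \<le> of_int K * w"
  proof -
    have "of_int (2 ^ (p - 1)) \<le> (of_int K :: real)"
      using K(1) by (simp only: of_int_le_iff)
    then show ?thesis
      unfolding ew using w by simp
  qed
  have mem: "of_int K * w \<in> fp_numbers p"
    unfolding fp_numbers_def w_def using K K0 by force
  have mem': "(of_int K + 1) * w \<in> fp_numbers p"
  proof (cases "K + 1 < 2 ^ p")
    case True
    then have "(of_int K + 1) * w = of_int (K + 1) * 2 powi (\<lfloor>log 2 y\<rfloor> + 1 - int p)" "\<bar>K + 1\<bar> < 2 ^ p"
      using K0 by (auto simp: w_def)
    then show ?thesis
      unfolding fp_numbers_def by blast
  next
    \<comment> \<open>Here \<open>K + 1\<close> is too large for a significand, but the point is the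
      start of the next binade and is representable with significand 1.\<close>
    case False
    then have "K + 1 = 2 ^ p"
      using K by linarith
    then have "(of_int K + 1 :: real) = 2 ^ p"
      by (metis of_int_1 of_int_add of_int_numeral of_int_power)
    then have "(of_int K + 1) * w = of_int 1 * 2 powi (e + 1)"
      by (simp add: ew)
    moreover have "\<bar>1 :: int\<bar> < 2 ^ p"
      using p by simp
    ultimately show ?thesis
      unfolding fp_numbers_def by blast
  qed
  \<comment> \<open>From \<open>2 powi e\<close> on, floating-point numbers are multiples of
    \<open>w\<close>, so none lies strictly between consecutive multiples; smaller ones are below
    \<open>of_int K * w\<close> by \<open>eK\<close>.\<close>
  have gap: "z \<le> of_int K * w" if z: "z \<in> fp_numbers p" "z < (of_int K + 1) * w" for z
  proof (cases "2 powi e \<le> z")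
    case True
    then obtain k where k: "z = of_int k * w"
      using fp_numbers_multiple_of_ulp[OF z(1)] unfolding w_def e_def by blast
    then have "of_int k < (of_int K + 1 :: real)"
      using z(2) w by simp
    then show ?thesis
      using w by (simp add: k)
  next
    case False
    then show ?thesis
      using eK by linarith
  qed
  have gap': "(of_int K + 1) * w \<le> z" if z: "z \<in> fp_numbers p" "y \<le> z" for z
  proof (rule ccontr)
    assume "\<not> ?thesis"
    then have "z \<le> of_int K * w"
      using gap[OF z(1)] by linarith
    then have "y = of_int K * w"
      using z(2) Kw(1) by linarith
    then show False
      using mem ny by simp
  qed
  have lt: "z < (of_int K + 1) * w" if "z \<le> y" for z
    using that Kw(2) by linarith
  show floor: "fp_floor p y = of_int \<lfloor>y / w\<rfloor> * w"
    unfolding fp_floor_def K_def[symmetric]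
    by (rule Greatest_equality) (use mem Kw gap lt in auto)
  show ceil: "fp_ceil p y = (of_int \<lfloor>y / w\<rfloor> + 1) * w"
    unfolding fp_ceil_def K_def[symmetric]
    by (rule Least_equality) (use mem' Kw gap' in auto)
  show "fp_floor p (- y) = - fp_ceil p y"
    unfolding ceil unfolding fp_floor_def K_def[symmetric]
  proof (rule Greatest_equality)
    fix z assume "z \<in> fp_numbers p \<and> z \<le> - y"
    then show "z \<le> - ((of_int K + 1) * w)"
      using gap'[of "- z"] by simp
  qed (use mem' Kw fp_numbers_uminus_iff in auto)
  show "fp_ceil p (- y) = - fp_floor p y"
    unfolding floor unfolding fp_ceil_def K_def[symmetric]
  proof (rule Least_equality)
    fix z assume "z \<in> fp_numbers p \<and> - y \<le> z"
    then show "- (of_int K * w) \<le> z"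
      using gap[of "- z"] lt[of "- z"] by simp
  qed (use mem Kw fp_numbers_uminus_iff in auto)
  have "w = unit_roundoff p * 2 powi e"
    by (simp add: w_def unit_roundoff_def e_def algebra_simps flip: power_int_add)
  then show "w \<le> unit_roundoff p * y"
    using ey by (simp add: unit_roundoff_def)
qed

section \<open>Truncation and its position between the neighbours\<close>

lemma fl_trunc_pos:
  fixes y :: real
  assumes k: "k > 0" and y: "y > 0"
  defines "w \<equiv> 2 powi (\<lfloor>log 2 y\<rfloor> + 1 - int k)"
  shows "fl_trunc k y = of_int \<lfloor>y / w\<rfloor> * w"
proof -
  \<comment> \<open>\<open>q\<close> is the position after the binary point of the last digit kept;
    \<open>truncate_down\<close> receives the precision \<open>k - 1\<close>.\<close>
  define q where "q = int k - 1 - \<lfloor>log 2 y\<rfloor>"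
  have "w = 2 powr - of_int q"
    by (simp add: w_def q_def algebra_simps flip: powr_real_of_int')
  moreover have "fl_trunc k y = round_down q y"
    using k y by (simp add: fl_trunc_def truncate_down_def q_def of_nat_diff)
  moreover from calculation have "y / w = y * 2 powr of_int q"
    by (simp add: powr_minus divide_inverse)
  ultimately show ?thesis
    by (simp add: round_down_def)
qed

lemma fl_trunc_uminus: "fl_trunc k (- y) = - fl_trunc k y"
  by (simp add: fl_trunc_def sgn_minus)

lemma fl_trunc_le_pos: "y > 0 \<Longrightarrow> fl_trunc k y \<le> y"
  by (simp add: fl_trunc_def truncate_down)

lemma fl_trunc_error_pos:
  assumes "k > 0" "y > 0"
  shows "y - fl_trunc k y \<le> unit_roundoff k * y"
proof -
  define e where "e = \<lfloor>log 2 y\<rfloor>"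
  define w :: real where "w = 2 powi (e + 1 - int k)"
  have w: "w > 0"
    by (simp add: w_def)
  have "2 powr of_int e \<le> y"
    using assms by (simp add: e_def le_log_iff[symmetric])
  then have ey: "2 powi e \<le> y"
    by (simp flip: powr_real_of_int')
  have "w = unit_roundoff k * 2 powi e"
    by (simp add: w_def unit_roundoff_def e_def algebra_simps flip: power_int_add)
  also have "\<dots> \<le> unit_roundoff k * y"
    using ey by (simp add: unit_roundoff_def)
  finally have "w \<le> unit_roundoff k * y" .
  moreover have "y - of_int \<lfloor>y / w\<rfloor> * w \<le> w"
  proof -
    have "y / w \<le> of_int \<lfloor>y / w\<rfloor> + 1"
      by linarith
    then show ?thesis
      using w by (simp add: field_simps)
  qed
  ultimately show ?thesis
    using fl_trunc_pos[OF assms] by (simp add: w_def e_def)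
qed

text \<open>The grid for \<open>p\<close> digits is \<open>2 ^ r\<close> times coarser than that for
  \<open>p + r\<close> digits and contained in it, so the floor on the finer grid cannot drop below
  the coarse one. For positive \<open>y\<close> this makes \<open>sr_prob\<close>
  nonnegative.\<close>

lemma fl_trunc_add_precision_ge:
  assumes p: "p > 0" and y: "y > 0"
  shows "of_int \<lfloor>y / 2 powi (\<lfloor>log 2 y\<rfloor> + 1 - int p)\<rfloor> * 2 powi (\<lfloor>log 2 y\<rfloor> + 1 - int p) \<le> fl_trunc (p + r) y"
proof -
  define w :: real where "w = 2 powi (\<lfloor>log 2 y\<rfloor> + 1 - int p)"
  define w' :: real where "w' = 2 powi (\<lfloor>log 2 y\<rfloor> + 1 - int (p + r))"
  have w': "w' > 0" and w: "w > 0"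
    by (simp_all add: w'_def w_def)
  have ww': "w = of_int (2 ^ r) * w'"
  proof -
    have "w = 2 powi (int r + (\<lfloor>log 2 y\<rfloor> + 1 - int (p + r)))"
      unfolding w_def by (rule arg_cong) simp
    also have "\<dots> = 2 powi int r * w'"
      unfolding w'_def by (rule power_int_add) simp
    finally show ?thesis
      by simp
  qed
  have "of_int \<lfloor>y / w\<rfloor> * w \<le> y"
    using w by (simp add: pos_le_divide_eq[symmetric])
  then have "of_int (\<lfloor>y / w\<rfloor> * 2 ^ r) \<le> y / w'"
    using w' by (simp add: ww' field_simps)
  then have "\<lfloor>y / w\<rfloor> * 2 ^ r \<le> \<lfloor>y / w'\<rfloor>"
    by (simp only: le_floor_iff)
  then have "of_int (\<lfloor>y / w\<rfloor> * 2 ^ r) * w' \<le> of_int \<lfloor>y / w'\<rfloor> * w'"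
    using w' by (intro mult_right_mono) (simp_all only: of_int_le_iff less_imp_le)
  moreover have "of_int (\<lfloor>y / w\<rfloor> * 2 ^ r) * w' = of_int \<lfloor>y / w\<rfloor> * w"
    by (simp add: ww')
  moreover have "fl_trunc (p + r) y = of_int \<lfloor>y / w'\<rfloor> * w'"
    unfolding w'_def by (rule fl_trunc_pos) (use p y in auto)
  ultimately show ?thesis
    unfolding w_def[symmetric] by linarith
qed

text \<open>Negative \<open>y\<close> reduces to positive \<open>y\<close> by reflection: floor and
  ceiling swap with a change of sign and truncation toward zero is odd, so \<open>?P\<close> is
  preserved.\<close>

lemma sr_neighbours:
  assumes p: "p > 0" and ny: "y \<notin> fp_numbers p"
  shows "fp_floor p y \<le> fl_trunc (p + r) y" "fl_trunc (p + r) y \<le> fp_ceil p y"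
    and "fp_floor p y \<le> y" "y \<le> fp_ceil p y" "fp_floor p y < fp_ceil p y"
    and "fp_ceil p y - fp_floor p y \<le> unit_roundoff p * \<bar>y\<bar>"
    and "\<bar>fl_trunc (p + r) y - y\<bar> \<le> unit_roundoff (p + r) * \<bar>y\<bar>"
proof -
  let ?P = "\<lambda>y. fp_floor p y \<le> fl_trunc (p + r) y \<and> fl_trunc (p + r) y \<le> fp_ceil p y \<and>
    fp_floor p y \<le> y \<and> y \<le> fp_ceil p y \<and> fp_floor p y < fp_ceil p y \<and>
    fp_ceil p y - fp_floor p y \<le> unit_roundoff p * \<bar>y\<bar> \<and>
    \<bar>fl_trunc (p + r) y - y\<bar> \<le> unit_roundoff (p + r) * \<bar>y\<bar>"
  have pos: "?P y" if y: "y > 0" and ny: "y \<notin> fp_numbers p" for y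
  proof -
    define w :: real where "w = 2 powi (\<lfloor>log 2 y\<rfloor> + 1 - int p)"
    have w: "w > 0"
      by (simp add: w_def)
    have "of_int \<lfloor>y / w\<rfloor> * w \<le> y" "y \<le> (of_int \<lfloor>y / w\<rfloor> + 1) * w"
      using w by (simp_all add: pos_le_divide_eq[symmetric] pos_divide_le_eq[symmetric])
    moreover have "of_int \<lfloor>y / w\<rfloor> * w \<le> fl_trunc (p + r) y"
      unfolding w_def by (rule fl_trunc_add_precision_ge[OF p y])
    moreover note fp_neighbours_pos[OF p y ny, folded w_def] fl_trunc_le_pos[OF y, of "p + r"]
      fl_trunc_error_pos[of "p + r" y]
    ultimately show ?thesis
      using p w y by (simp add: algebra_simps)
  qed
  have "y \<noteq> 0"
    using ny by auto
  then have "?P y"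
  proof (cases "y > 0")
    case False
    with \<open>y \<noteq> 0\<close> have y': "- y > 0" "- y \<notin> fp_numbers p"
      using ny by auto
    then show ?thesis
      using pos[OF y'] fp_neighbours_pos(3,4)[OF p y'] by (auto simp: fl_trunc_uminus)
  qed (use pos ny in auto)
  then show "fp_floor p y \<le> fl_trunc (p + r) y" "fl_trunc (p + r) y \<le> fp_ceil p y"
    and "fp_floor p y \<le> y" "y \<le> fp_ceil p y" "fp_floor p y < fp_ceil p y"
    and "fp_ceil p y - fp_floor p y \<le> unit_roundoff p * \<bar>y\<bar>"
    and "\<bar>fl_trunc (p + r) y - y\<bar> \<le> unit_roundoff (p + r) * \<bar>y\<bar>"
    by auto
qed

section \<open>Moment generating function of a single rounding\<close>

text \<open>Negative \<open>t\<close> is reduced to a positive parameter by reflecting the variable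
  to \<open>- x\<close>, with values between \<open>- b\<close> and \<open>- a\<close>.\<close>

lemma Hoeffdings_lemma_pmf:
  fixes M :: "real pmf"
  assumes "set_pmf M \<subseteq> {a..b}"
  shows "(\<integral>\<^sup>+x. ennreal (exp (t * (x - measure_pmf.expectation M (\<lambda>x. x)))) \<partial>M) \<le> ennreal (exp (t\<^sup>2 * (b - a)\<^sup>2 / 8))"
proof -
  have AE: "AE x in M. x \<in> {a..b}"
    using assms by (auto simp: AE_measure_pmf_iff)
  consider "t > 0" | "t = 0" | "- t > 0"
    by linarith
  then show ?thesis
  proof cases
    case 1
    interpret interval_bounded_random_variable M "\<lambda>x. x" a b
      by unfold_locales (use AE in auto)
    show ?thesis
      using Hoeffdings_lemma_nn_integral[OF 1] by simp
  next
    case 3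
    interpret interval_bounded_random_variable M "\<lambda>x. - x" "- b" "- a"
      by unfold_locales (use AE in auto)
    show ?thesis
      using Hoeffdings_lemma_nn_integral[OF 3] by (simp add: algebra_simps)
  qed simp
qed

text \<open>The mean of the rounding is \<open>fl_trunc (p + r) y\<close>. Comparison with
  \<open>y\<close> therefore gives a linear term from the truncation error and Hoeffding's term for
  the interval between the neighbours.\<close>

lemma stoch_round_mgf:
  assumes p: "p > 0"
  shows "(\<integral>\<^sup>+x. ennreal (exp (t * x)) \<partial>stoch_round p r y)
    \<le> ennreal (exp (t * y + (\<bar>t\<bar> * (unit_roundoff (p + r) * \<bar>y\<bar>) + t\<^sup>2 * (unit_roundoff p * \<bar>y\<bar>)\<^sup>2 / 8)))"
proof (cases "y \<in> fp_numbers p")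
  case True
  have "0 \<le> unit_roundoff (p + r)"
    by (simp add: unit_roundoff_def)
  with True show ?thesis
    by (auto simp: stoch_round_def intro!: ennreal_leI)
next
  case False
  note fl = sr_neighbours(1,2,7)[OF p False, of r] and nb = sr_neighbours(5,6)[OF p False]
  let ?M = "stoch_round p r y" and ?m = "fl_trunc (p + r) y"
  let ?lo = "fp_floor p y" and ?hi = "fp_ceil p y"
  \<comment> \<open>\<open>bernoulli_pmf\<close> clips its parameter to the unit interval; these
    bounds make \<open>sr_prob p r y\<close> the actual probability of rounding up.\<close>
  have q: "0 \<le> sr_prob p r y" "sr_prob p r y \<le> 1"
    using fl nb by (auto simp: sr_prob_def)
  have mean: "measure_pmf.expectation ?M (\<lambda>x. x) = ?m"
  proof -
    have "measure_pmf.expectation ?M (\<lambda>x. x) = ?lo + sr_prob p r y * (?hi - ?lo)"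
      using False q by (simp add: stoch_round_def algebra_simps)
    also have "\<dots> = ?m"
      using nb(1) by (simp add: sr_prob_def)
    finally show ?thesis .
  qed
  have "set_pmf ?M \<subseteq> {?lo..?hi}"
    using False nb(1) by (auto simp: stoch_round_def)
  note H = Hoeffdings_lemma_pmf[OF this, of t, unfolded mean]
  have "(\<integral>\<^sup>+x. ennreal (exp (t * x)) \<partial>?M) = (\<integral>\<^sup>+x. ennreal (exp (t * ?m)) * ennreal (exp (t * (x - ?m))) \<partial>?M)"
    by (simp add: algebra_simps flip: ennreal_mult exp_add)
  also have "\<dots> \<le> ennreal (exp (t * ?m)) * ennreal (exp (t\<^sup>2 * (?hi - ?lo)\<^sup>2 / 8))"
    using H by (simp add: nn_integral_cmult mult_left_mono)
  also have "\<dots> = ennreal (exp (t * ?m + t\<^sup>2 * (?hi - ?lo)\<^sup>2 / 8))"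
    by (simp add: exp_add ennreal_mult)
  also have "\<dots> \<le> ennreal (exp (t * y + (\<bar>t\<bar> * (unit_roundoff (p + r) * \<bar>y\<bar>) + t\<^sup>2 * (unit_roundoff p * \<bar>y\<bar>)\<^sup>2 / 8)))"
  proof -
    have "t * (?m - y) \<le> \<bar>t\<bar> * \<bar>?m - y\<bar>"
      by (metis abs_ge_self abs_mult)
    also have "\<dots> \<le> \<bar>t\<bar> * (unit_roundoff (p + r) * \<bar>y\<bar>)"
      using fl(3) by (intro mult_left_mono) auto
    finally have "t * ?m \<le> t * y + \<bar>t\<bar> * (unit_roundoff (p + r) * \<bar>y\<bar>)"
      by (simp add: algebra_simps)
    moreover have "t\<^sup>2 * (?hi - ?lo)\<^sup>2 \<le> t\<^sup>2 * (unit_roundoff p * \<bar>y\<bar>)\<^sup>2"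
      using nb by (intro mult_left_mono power_mono) auto
    ultimately show ?thesis
      by (intro ennreal_leI) simp
  qed
  finally show ?thesis .
qed

lemma stoch_round_abs_le:
  assumes p: "p > 0" and x: "x \<in> set_pmf (stoch_round p r y)"
  shows "\<bar>x\<bar> \<le> (1 + unit_roundoff p) * \<bar>y\<bar>"
proof (cases "y \<in> fp_numbers p")
  case True
  have "0 \<le> unit_roundoff p * \<bar>y\<bar>"
    by (simp add: unit_roundoff_def)
  with True x show ?thesis
    by (simp add: stoch_round_def algebra_simps)
next
  case False
  note nb = sr_neighbours(3-6)[OF p False]
  have "x \<in> {fp_floor p y, fp_ceil p y}"
    using False x by (auto simp: stoch_round_def split: if_splits)
  with nb have "\<bar>x - y\<bar> \<le> unit_roundoff p * \<bar>y\<bar>"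
    by auto
  then show ?thesis
    by (simp add: algebra_simps)
qed

section \<open>Error propagation along the summation tree\<close>

text \<open>The interval on the left indexes the leaves below node \<open>i\<close> of level
  \<open>Suc j\<close>; it is cut into the leaves of the children \<open>2 * i - 1\<close> and
  \<open>2 * i\<close>.\<close>

lemma sum_pairwise_block:
  fixes f :: "nat \<Rightarrow> real" and i j :: nat
  assumes "i \<ge> 1"
  shows "(\<Sum>k\<in>{2 ^ Suc j * (i - 1)<..2 ^ Suc j * i}. f k) =
    (\<Sum>k\<in>{2 ^ j * (2 * i - 1 - 1)<..2 ^ j * (2 * i - 1)}. f k) + (\<Sum>k\<in>{2 ^ j * (2 * i - 1)<..2 ^ j * (2 * i)}. f k)"
proof -
  have eq: "(2::nat) ^ Suc j * (i - 1) = 2 ^ j * (2 * i - 1 - 1)" "(2::nat) ^ Suc j * i = 2 ^ j * (2 * i)"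
    by (simp_all add: algebra_simps)
  have "{2 ^ j * (2 * i - 1 - 1)<..2 ^ j * (2 * i)} =
      {2 ^ j * (2 * i - 1 - 1)<..2 ^ j * (2 * i - 1)} \<union> {2 ^ j * (2 * i - 1)<..2 ^ j * (2 * i)}"
    by (rule ivl_disj_un_two(6)[symmetric]) (simp_all add: mult_le_mono2)
  then show ?thesis
    unfolding eq by (simp add: sum.union_disjoint ivl_disj_int)
qed

text \<open>The bound holds for every outcome. It allows the random argument of a rounding to be
  replaced by a constant in the moment bound.\<close>

lemma pairwise_node_abs_le:
  assumes p: "p > 0" and "i \<ge> 1" and "x \<in> set_pmf (pairwise_node p r b j i)"
  shows "\<bar>x\<bar> \<le> (1 + unit_roundoff p) ^ j * (\<Sum>k\<in>{2 ^ j * (i - 1)<..2 ^ j * i}. \<bar>b k\<bar>)"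
  using assms(2-)
proof (induction j arbitrary: i x)
  case 0
  \<comment> \<open>Positions start at 1; for \<open>i = 0\<close>, subtraction on naturals would
    leave the interval empty.\<close>
  have "{i - Suc 0<..i} = {i}"
    using 0 by auto
  with 0 show ?case by simp
next
  case (Suc j)
  have u: "unit_roundoff p \<ge> 0"
    by (simp add: unit_roundoff_def)
  obtain xl xr where xl: "xl \<in> set_pmf (pairwise_node p r b j (2 * i - 1))"
    and xr: "xr \<in> set_pmf (pairwise_node p r b j (2 * i))"
    and x: "x \<in> set_pmf (stoch_round p r (xl + xr))"
    using Suc.prems(2) by auto
  have "\<bar>x\<bar> \<le> (1 + unit_roundoff p) * \<bar>xl + xr\<bar>"
    by (rule stoch_round_abs_le[OF p x])
  also have "\<dots> \<le> (1 + unit_roundoff p) * (\<bar>xl\<bar> + \<bar>xr\<bar>)"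
    using u by (intro mult_left_mono) auto
  also have "\<dots> \<le> (1 + unit_roundoff p) * ((1 + unit_roundoff p) ^ j *
      (\<Sum>k\<in>{2 ^ Suc j * (i - 1)<..2 ^ Suc j * i}. \<bar>b k\<bar>))"
    using Suc.IH[OF _ xl] Suc.IH[OF _ xr] Suc.prems(1) u
    unfolding sum_pairwise_block[OF Suc.prems(1)] distrib_left[of "_ ^ j"]
    by (intro mult_left_mono add_mono) auto
  finally show ?case
    by (simp only: power_Suc mult.assoc)
qed

text \<open>
  Rounding contributes to the exponent a bias term, linear in \<open>t\<close>, and a Hoeffding term, quadratic
  in \<open>t\<close>. The variance proxies of the two subtrees add up because their values are independent,
  and \<open>A\<^sub>l\<^sup>2 + A\<^sub>r\<^sup>2 \<le> (A\<^sub>l + A\<^sub>r)\<^sup>2\<close>.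
\<close>

lemma pairwise_node_mgf:
  fixes b :: "nat \<Rightarrow> real" and p r :: nat
  assumes p: "p > 0" and "i \<ge> 1"
  defines "u \<equiv> unit_roundoff p" and "v \<equiv> unit_roundoff (p + r)"
  defines "B \<equiv> \<lambda>j i. {2 ^ j * (i - 1)<..2 ^ j * i}"
  shows "(\<integral>\<^sup>+x. ennreal (exp (t * (x - (\<Sum>k\<in>B j i. b k)))) \<partial>pairwise_node p r b j i)
    \<le> ennreal (exp (\<bar>t\<bar> * ((\<Sum>k\<in>B j i. \<bar>b k\<bar>) * (gamma_err j (u + v) - gamma_err j u))
        + t\<^sup>2 * ((\<Sum>k\<in>B j i. \<bar>b k\<bar>)\<^sup>2 * (u * gamma_err (2 * j) u)) / 8))"
  using \<open>i \<ge> 1\<close>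
proof (induction j arbitrary: i)
  case 0
  have "{i - Suc 0<..i} = {i}"
    using 0 by auto
  then show ?case
    by (simp add: B_def gamma_err_def)
next
  case (Suc j)
  have u: "u \<ge> 0" and v: "v \<ge> 0"
    by (simp_all add: u_def v_def unit_roundoff_def)
  let ?L = "pairwise_node p r b j (2 * i - 1)" and ?R = "pairwise_node p r b j (2 * i)"
  define D where "D = (\<lambda>j. gamma_err j (u + v) - gamma_err j u)"
  define W where "W = (\<lambda>j. u * gamma_err (2 * j) u)"
  define Al where "Al = (\<Sum>k\<in>B j (2 * i - 1). \<bar>b k\<bar>)"
  define Ar where "Ar = (\<Sum>k\<in>B j (2 * i). \<bar>b k\<bar>)"
  define sl where "sl = (\<Sum>k\<in>B j (2 * i - 1). b k)"
  define sr where "sr = (\<Sum>k\<in>B j (2 * i). b k)"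
  \<comment> \<open>The exponent contributed by the rounding at this node, with the modulus of its
    argument replaced by the worst case over all outcomes of the children.\<close>
  define c where "c = \<bar>t\<bar> * (v * ((1 + u) ^ j * (Al + Ar))) + t\<^sup>2 * (u * ((1 + u) ^ j * (Al + Ar)))\<^sup>2 / 8"
  define El where "El = \<bar>t\<bar> * (Al * D j) + t\<^sup>2 * (Al\<^sup>2 * W j) / 8"
  define Er where "Er = \<bar>t\<bar> * (Ar * D j) + t\<^sup>2 * (Ar\<^sup>2 * W j) / 8"
  have A: "Al \<ge> 0" "Ar \<ge> 0" "(\<Sum>k\<in>B (Suc j) i. \<bar>b k\<bar>) = Al + Ar"
    and s: "(\<Sum>k\<in>B (Suc j) i. b k) = sl + sr"
    unfolding Al_def Ar_def sl_def sr_def B_def by (simp_all only: sum_pairwise_block[OF Suc.prems] sum_nonneg abs_ge_zero)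
  \<comment> \<open>For fixed children in the supports, the bound is a constant times a function of
    \<open>xl\<close> times a function of \<open>xr\<close>, so the iterated integral over
    independent children becomes a product.\<close>
  have step: "(\<integral>\<^sup>+x. ennreal (exp (t * (x - (sl + sr)))) \<partial>stoch_round p r (xl + xr))
      \<le> ennreal (exp c) * ennreal (exp (t * (xl - sl))) * ennreal (exp (t * (xr - sr)))"
    if "xl \<in> set_pmf ?L" "xr \<in> set_pmf ?R" for xl xr
  proof -
    have "\<bar>xl\<bar> \<le> (1 + u) ^ j * Al" "\<bar>xr\<bar> \<le> (1 + u) ^ j * Ar"
      using pairwise_node_abs_le[OF p _ that(1)] pairwise_node_abs_le[OF p _ that(2)] Suc.prems
      by (auto simp: u_def Al_def Ar_def B_def)
    then have y: "\<bar>xl + xr\<bar> \<le> (1 + u) ^ j * (Al + Ar)"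
      by (simp add: distrib_left)
    have "(\<integral>\<^sup>+x. ennreal (exp (t * (x - (sl + sr)))) \<partial>stoch_round p r (xl + xr)) =
        (\<integral>\<^sup>+x. ennreal (exp (- t * (sl + sr))) * ennreal (exp (t * x)) \<partial>stoch_round p r (xl + xr))"
      by (simp add: algebra_simps flip: ennreal_mult exp_add)
    also have "\<dots> = ennreal (exp (- t * (sl + sr))) * (\<integral>\<^sup>+x. ennreal (exp (t * x)) \<partial>stoch_round p r (xl + xr))"
      by (simp add: nn_integral_cmult)
    also have "\<dots> \<le> ennreal (exp (- t * (sl + sr))) * ennreal (exp (t * (xl + xr) +
        (\<bar>t\<bar> * (v * \<bar>xl + xr\<bar>) + t\<^sup>2 * (u * \<bar>xl + xr\<bar>)\<^sup>2 / 8)))"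
      unfolding u_def v_def by (intro mult_left_mono stoch_round_mgf p) auto
    also have "\<dots> \<le> ennreal (exp (- t * (sl + sr))) * ennreal (exp (t * (xl + xr) + c))"
      unfolding c_def using u v y
      by (intro mult_left_mono ennreal_leI exp_le_cancel_iff[THEN iffD2] add_mono divide_right_mono power_mono order_refl) auto
    also have "\<dots> = ennreal (exp c) * ennreal (exp (t * (xl - sl))) * ennreal (exp (t * (xr - sr)))"
      by (simp add: algebra_simps flip: ennreal_mult exp_add)
    finally show ?thesis .
  qed
  have "(\<integral>\<^sup>+x. ennreal (exp (t * (x - (\<Sum>k\<in>B (Suc j) i. b k)))) \<partial>pairwise_node p r b (Suc j) i)
      = (\<integral>\<^sup>+xl. \<integral>\<^sup>+xr. \<integral>\<^sup>+x. ennreal (exp (t * (x - (sl + sr)))) \<partial>stoch_round p r (xl + xr) \<partial>?R \<partial>?L)"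
    unfolding s by simp
  also have "\<dots> \<le> (\<integral>\<^sup>+xl. \<integral>\<^sup>+xr. ennreal (exp c) * ennreal (exp (t * (xl - sl))) * ennreal (exp (t * (xr - sr))) \<partial>?R \<partial>?L)"
    by (rule nn_integral_mono_AE, unfold AE_measure_pmf_iff, rule ballI, rule nn_integral_mono_AE,
        unfold AE_measure_pmf_iff, rule ballI) (rule step)
  also have "\<dots> = ennreal (exp c) * (\<integral>\<^sup>+xl. ennreal (exp (t * (xl - sl))) \<partial>?L) * (\<integral>\<^sup>+xr. ennreal (exp (t * (xr - sr))) \<partial>?R)"
    by (simp add: nn_integral_cmult nn_integral_multc)
  also have "\<dots> \<le> ennreal (exp c) * ennreal (exp El) * ennreal (exp Er)"
    unfolding sl_def sr_def El_def Er_def Al_def Ar_def D_def W_def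
    using Suc.prems by (intro mult_mono order_refl Suc.IH) auto
  also have "\<dots> = ennreal (exp (c + El + Er))"
    by (simp add: exp_add ennreal_mult)
  also have "\<dots> \<le> ennreal (exp (\<bar>t\<bar> * ((Al + Ar) * D (Suc j)) + t\<^sup>2 * ((Al + Ar)\<^sup>2 * W (Suc j)) / 8))"
  proof -
    \<comment> \<open>The increment of \<open>D\<close> is
      \<open>(u + v) * (1 + (u + v)) ^ j - u * (1 + u) ^ j\<close>; lowering the first base to
      \<open>1 + u\<close> leaves \<open>v * (1 + u) ^ j\<close>.\<close>
    have D: "v * (1 + u) ^ j + D j \<le> D (Suc j)"
    proof -
      have "(1 + u) ^ j \<le> (1 + (u + v)) ^ j"
        using u v by (intro power_mono) auto
      then have "(u + v) * (1 + u) ^ j \<le> (u + v) * (1 + (u + v)) ^ j"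
        using u v by (intro mult_left_mono) auto
      then show ?thesis
        by (simp add: D_def gamma_err_def algebra_simps)
    qed
    have "(Al + Ar) * (v * (1 + u) ^ j + D j) \<le> (Al + Ar) * D (Suc j)"
      using A by (intro mult_left_mono D) auto
    then have 1: "v * ((1 + u) ^ j * (Al + Ar)) + Al * D j + Ar * D j \<le> (Al + Ar) * D (Suc j)"
      by (simp add: algebra_simps)
    have W0: "W j \<ge> 0"
      using u by (simp add: W_def gamma_err_def)
    \<comment> \<open>Raising the level by one adds two factors \<open>1 + u\<close> inside
      \<open>gamma_err\<close>, whence \<open>2 * u + u\<^sup>2\<close>, of which a single
      \<open>u\<close> suffices.\<close>
    have W: "(u * (1 + u) ^ j)\<^sup>2 + W j \<le> W (Suc j)"
    proof -
      have "W (Suc j) - W j = u * (2 * u + u\<^sup>2) * ((1 + u) ^ j)\<^sup>2"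
        by (simp add: W_def gamma_err_def algebra_simps power2_eq_square power_mult)
      moreover have "u\<^sup>2 * ((1 + u) ^ j)\<^sup>2 \<le> u * (2 * u + u\<^sup>2) * ((1 + u) ^ j)\<^sup>2"
        using u by (intro mult_right_mono) (auto simp: power2_eq_square algebra_simps)
      ultimately show ?thesis
        by (simp add: power_mult_distrib)
    qed
    have "Al\<^sup>2 + Ar\<^sup>2 \<le> (Al + Ar)\<^sup>2"
      using A by (simp add: power2_sum)
    then have "(u * ((1 + u) ^ j * (Al + Ar)))\<^sup>2 + (Al\<^sup>2 + Ar\<^sup>2) * W j \<le> (u * ((1 + u) ^ j * (Al + Ar)))\<^sup>2 + (Al + Ar)\<^sup>2 * W j"
      using W0 by (intro add_left_mono mult_right_mono)
    also have "\<dots> = (Al + Ar)\<^sup>2 * ((u * (1 + u) ^ j)\<^sup>2 + W j)"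
      by (simp only: distrib_left power_mult_distrib mult_ac)
    also have "\<dots> \<le> (Al + Ar)\<^sup>2 * W (Suc j)"
      by (intro mult_left_mono W) auto
    finally have 2: "(u * ((1 + u) ^ j * (Al + Ar)))\<^sup>2 + (Al\<^sup>2 + Ar\<^sup>2) * W j \<le> (Al + Ar)\<^sup>2 * W (Suc j)" .
    have "c + El + Er = \<bar>t\<bar> * (v * ((1 + u) ^ j * (Al + Ar)) + Al * D j + Ar * D j) +
        t\<^sup>2 * ((u * ((1 + u) ^ j * (Al + Ar)))\<^sup>2 + (Al\<^sup>2 + Ar\<^sup>2) * W j) / 8"
      by (simp add: c_def El_def Er_def algebra_simps add_divide_distrib)
    also have "\<dots> \<le> \<bar>t\<bar> * ((Al + Ar) * D (Suc j)) + t\<^sup>2 * ((Al + Ar)\<^sup>2 * W (Suc j)) / 8"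
      using 1 2 by (intro add_mono divide_right_mono mult_left_mono) auto
    finally show ?thesis
      by (simp add: ennreal_leI)
  qed
  finally show ?case
    by (simp only: A D_def W_def)
qed

section \<open>Tail bound and final estimate\<close>

text \<open>Chernoff's inequality is applied to \<open>x - m\<close> and to its negative. The shift
  \<open>B\<close> in the threshold cancels the linear term of the exponent, and each side costs at
  most \<open>exp (- L)\<close>.\<close>

lemma subgaussian_tail_two_sided:
  fixes M :: "real pmf"
  assumes mgf: "\<And>t. (\<integral>\<^sup>+x. ennreal (exp (t * (x - m))) \<partial>M) \<le> ennreal (exp (\<bar>t\<bar> * B + t\<^sup>2 * V / 8))"
    and V: "V > 0" and L: "L \<ge> 0"
  shows "measure_pmf.prob M {x. \<bar>x - m\<bar> > B + sqrt V * sqrt L} \<le> 2 * exp (- L)"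
proof -
  \<comment> \<open>For \<open>L = 0\<close> the Chernoff parameter below would vanish, but the
    claimed bound is then 2.\<close>
  consider "L = 0" | "L > 0"
    using L by linarith
  then show ?thesis
  proof cases
    case 1
    have "measure_pmf.prob M {x. \<bar>x - m\<bar> > B + sqrt V * sqrt L} \<le> 1"
      by (rule measure_pmf.prob_le_1)
    then have "measure_pmf.prob M {x. \<bar>x - m\<bar> > B + sqrt V * sqrt L} \<le> 2"
      by linarith
    then show ?thesis
      using 1 by simp
  next
    case L: 2
    \<comment> \<open>The exponent is minimal at twice this value, where it equals
      \<open>- 2 * L\<close>; the present choice gives \<open>- (3 / 2) * L\<close>, which still
      lies below \<open>- L\<close>.\<close>
    define t where "t = 2 * sqrt L / sqrt V"
    define \<epsilon> where "\<epsilon> = B + sqrt V * sqrt L"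
    have t: "t > 0"
      using V L by (simp add: t_def)
    have tail: "measure_pmf.prob M {x. \<epsilon> \<le> \<sigma> * (x - m)} \<le> exp (- L)" if \<sigma>: "\<bar>\<sigma>\<bar> = 1" for \<sigma>
    proof -
      have "emeasure M {x \<in> UNIV. \<epsilon> \<le> \<sigma> * (x - m)}
          \<le> ennreal (exp (- t * \<epsilon>)) * (\<integral>\<^sup>+x. ennreal (exp (t * (\<sigma> * (x - m)))) * indicator UNIV x \<partial>M)"
        by (rule Chernoff_ineq_nn_integral_ge[OF t]) auto
      also have "\<dots> \<le> ennreal (exp (- t * \<epsilon>)) * ennreal (exp (\<bar>t * \<sigma>\<bar> * B + (t * \<sigma>)\<^sup>2 * V / 8))"
        using mgf[of "t * \<sigma>"] by (intro mult_left_mono) (simp_all add: mult.assoc)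
      also have "\<dots> = ennreal (exp (- t * \<epsilon> + (t * B + t\<^sup>2 * V / 8)))"
      proof -
        have "\<sigma>\<^sup>2 = 1"
          using \<sigma> by (simp flip: power2_abs[of \<sigma>])
        then show ?thesis
          using \<sigma> t by (simp add: abs_mult power_mult_distrib flip: ennreal_mult exp_add)
      qed
      also have "- t * \<epsilon> + (t * B + t\<^sup>2 * V / 8) = - (3 / 2) * L"
      proof -
        have "t * (sqrt V * sqrt L) = 2 * L"
          using V L by (simp add: t_def)
        moreover have "t\<^sup>2 * V = 4 * L"
          using V L by (simp add: t_def power_divide power_mult_distrib)
        ultimately show ?thesis
          by (simp add: \<epsilon>_def distrib_left)
      qed
      also have "ennreal (exp (- (3 / 2) * L)) \<le> ennreal (exp (- L))"
        using L by (intro ennreal_leI) simp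
      finally show ?thesis
        by (simp add: measure_pmf.emeasure_eq_measure)
    qed
    have "measure_pmf.prob M {x. \<bar>x - m\<bar> > \<epsilon>}
        \<le> measure_pmf.prob M ({x. \<epsilon> \<le> 1 * (x - m)} \<union> {x. \<epsilon> \<le> - 1 * (x - m)})"
      by (intro measure_pmf.finite_measure_mono) auto
    also have "\<dots> \<le> measure_pmf.prob M {x. \<epsilon> \<le> 1 * (x - m)} + measure_pmf.prob M {x. \<epsilon> \<le> - 1 * (x - m)}"
      by (intro measure_Un_le) auto
    also have "\<dots> \<le> exp (- L) + exp (- L)"
      by (intro add_mono tail) auto
    finally show ?thesis
      by (simp add: \<epsilon>_def)
  qed
qed

lemma le_two_power_tree_depth: "n > 0 \<Longrightarrow> n \<le> 2 ^ tree_depth n"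
proof -
  assume n: "n > 0"
  have "log 2 (real n) \<le> real (tree_depth n)"
    unfolding tree_depth_def by linarith
  then have "real n \<le> 2 powr real (tree_depth n)"
    using n by (simp add: log_le_iff)
  then have "real n \<le> real (2 ^ tree_depth n)"
    by (simp add: powr_realpow)
  then show ?thesis
    by (simp only: of_nat_le_iff)
qed

theorem theorem2:
  fixes p r n :: nat and a :: "nat \<Rightarrow> real" and s lam :: real
  assumes "p > 0" and "r > 0" and "n > 0"
    and "\<And>i. i \<in> {1..n} \<Longrightarrow> a i \<in> fp_numbers p"
    and "s = (\<Sum>i=1..n. a i)" and "s \<noteq> 0"
    and "0 < lam" and "lam < 1"
  shows "measure_pmf.prob (pairwise_sum p r a n)
      {s_hat. \<bar>s_hat - s\<bar> / \<bar>s\<bar> \<le>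
         cond_number a n *
          (sqrt (unit_roundoff p * gamma_err (2 * tree_depth n) (unit_roundoff p)) * sqrt (ln (2 / lam))
           + gamma_err (tree_depth n) (unit_roundoff p + unit_roundoff (p + r))
           - gamma_err (tree_depth n) (unit_roundoff p))}
    \<ge> 1 - lam"
proof -
  define u where "u = unit_roundoff p"
  define v where "v = unit_roundoff (p + r)"
  define h where "h = tree_depth n"
  define A where "A = (\<Sum>i=1..n. \<bar>a i\<bar>)"
  define b where "b = (\<lambda>i. if i \<le> n then a i else 0)"
  define W where "W = u * gamma_err (2 * h) u"
  define D where "D = gamma_err h (u + v) - gamma_err h u"
  define M where "M = pairwise_node p r b h 1"
  define L where "L = ln (2 / lam)"
  let ?bad = "{x. \<bar>x - s\<bar> > A * D + sqrt (A\<^sup>2 * W) * sqrt L}"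
  have u: "u > 0"
    by (simp add: u_def unit_roundoff_def)
  have "\<bar>s\<bar> \<le> A"
    by (simp add: assms(5) A_def)
  then have A: "A > 0"
    using \<open>s \<noteq> 0\<close> by linarith
  \<comment> \<open>Padding leaves contribute \<open>f 0 = 0\<close>; the identity and the modulus
    are the two instances.\<close>
  have pad: "(\<Sum>i\<in>{0<..2 ^ h}. f (b i)) = (\<Sum>i=1..n. f (a i))"
    if "f 0 = 0" for f :: "real \<Rightarrow> real"
    using le_two_power_tree_depth[OF \<open>n > 0\<close>]
    by (intro sum.mono_neutral_cong_right) (auto simp: b_def h_def that)
  have s: "(\<Sum>i\<in>{0<..2 ^ h}. b i) = s" and sA: "(\<Sum>i\<in>{0<..2 ^ h}. \<bar>b i\<bar>) = A"
    using pad[of "\<lambda>x. x"] pad[of abs] by (simp_all add: A_def assms(5))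
  \<comment> \<open>Multiplication by \<open>\<bar>s\<bar>\<close> turns the condition number into
    \<open>A\<close>, and \<open>A\<close> moves under the square root as
    \<open>A\<^sup>2\<close>.\<close>
  have good: "{x. \<bar>x - s\<bar> / \<bar>s\<bar> \<le> cond_number a n *
      (sqrt W * sqrt L + gamma_err h (u + v) - gamma_err h u)} = - ?bad"
  proof -
    have "cond_number a n = A / \<bar>s\<bar>"
      by (simp add: cond_number_def A_def assms(5))
    moreover have "A * D + sqrt (A\<^sup>2 * W) * sqrt L = A * (sqrt W * sqrt L + gamma_err h (u + v) - gamma_err h u)"
      using A by (simp add: D_def real_sqrt_mult algebra_simps)
    ultimately show ?thesis
      using \<open>s \<noteq> 0\<close> by (auto simp: divide_le_cancel not_less)
  qed
  have "measure_pmf.prob M ?bad \<le> lam"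
  proof (cases "h = 0")
    \<comment> \<open>At depth 0 nothing is rounded and \<open>W\<close> vanishes, so the tail bound
      with its positive \<open>V\<close> does not apply; the result is exactly
      \<open>s\<close>.\<close>
    case True
    have "b 1 = s"
    proof -
      have "{0<..Suc 0} = {1}"
        by auto
      then show ?thesis
        using s True by simp
    qed
    then have "M = return_pmf s"
      using True by (simp add: M_def)
    then show ?thesis
      using True \<open>lam > 0\<close> by (simp add: W_def D_def gamma_err_def)
  next
    case False
    have "W > 0"
      using False u by (simp add: W_def gamma_err_def)
    have "measure_pmf.prob M ?bad \<le> 2 * exp (- L)"
    proof (rule subgaussian_tail_two_sided)
      show "(\<integral>\<^sup>+x. ennreal (exp (t * (x - s))) \<partial>M) \<le> ennreal (exp (\<bar>t\<bar> * (A * D) + t\<^sup>2 * (A\<^sup>2 * W) / 8))" for t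
        using pairwise_node_mgf[OF \<open>p > 0\<close>, where i = 1 and t = t and j = h and b = b and r = r]
        by (simp add: s sA M_def D_def W_def u_def v_def)
      show "A\<^sup>2 * W > 0"
        using A \<open>W > 0\<close> by simp
      show "L \<ge> 0"
        using assms(7,8) by (simp add: L_def)
    qed
    also have "2 * exp (- L) = lam"
      using \<open>lam > 0\<close> by (simp add: L_def exp_minus)
    finally show ?thesis .
  qed
  then have "1 - lam \<le> measure_pmf.prob M (- ?bad)"
    using measure_pmf.prob_compl[of ?bad M] by (simp add: Compl_eq_Diff_UNIV)
  then show ?thesis
    unfolding good[symmetric]
    by (simp add: M_def pairwise_sum_def b_def h_def L_def W_def u_def v_def)
qed

end
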